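(* Let $\Sigma\in\mathbb{R}^{n\times n}$ be (symmetric) positive definite, and let $u_1,\dots,u_m$ be i.i.d. random vectors with distribution $\mathcal{N}(0,\Sigma)$. Define the unnormalized sample covariance $$\widetilde\Sigma=\sum_{i=1}^m u_iu_i^T,$$ which has rank at most $m$. Fix any index set $S\subset\{1,\dots,n\}$ of size $s\le m$, and let $P_S\in\{0,1\}^{n\times s}$ be the coordinate-selection matrix for $S$. Then the $s\times s$ subblock $\widetilde\Sigma_S=P_S^T\,\widetilde\Sigma\,P_S$ follows the central Wishart distribution $W_s(P_S^T\Sigma P_S,\,m)$. Moreover, $\widetilde\Sigma_S$ is almost surely invertible, and hence $\operatorname{rank}(\widetilde\Sigma_S)=s$ almost surely.
   Context: The columns of $P_S$ are the standard basis vectors $e_i$ of $\mathbb{R}^n$ with $i\in S$, so $P_S^T M P_S$ is the principal submatrix of $M$ indexed by $S$. For a symmetric positive definite $\Gamma\in\mathbb{R}^{s\times s}$ and an integer $m\ge1$, the central Wishart distribution $W_s(\Gamma,m)$ is the law of $\sum_{i=1}^m v_iv_i^T$, where $v_1,\dots,v_m$ are i.i.d. $\mathcal{N}(0,\Gamma)$ random vectors in $\mathbb{R}^s$. *)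

theory Defs
  imports "HOL-Probability.Probability"
begin

definition positive_definite :: "real^'n^'n \<Rightarrow> bool" where
  "positive_definite A \<longleftrightarrow> transpose A = A \<and> (\<forall>x. x \<noteq> 0 \<longrightarrow> x \<bullet> (A *v x) > 0)"

(* The density formula gives N(0, A) for positive definite A only; singular covariances do not occur. *)
definition mvnormal_density :: "real^'n^'n \<Rightarrow> real^'n \<Rightarrow> real" where
  "mvnormal_density A x =
     exp (- (x \<bullet> (matrix_inv A *v x)) / 2) / sqrt ((2 * pi) ^ CARD('n) * det A)"

definition mvnormal :: "real^'n^'n \<Rightarrow> (real^'n) measure" where
  "mvnormal A = density lborel (\<lambda>x. ennreal (mvnormal_density A x))"

definition outer_prod :: "real^'n \<Rightarrow> real^'n^'n" where
  "outer_prod v = (\<chi> i j. v $ i * v $ j)"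

(* The i.i.d. vectors are the coordinates of the m-fold product of N(0, G); the law of the sum
   depends on their joint distribution only. *)
definition wishart :: "real^'s^'s \<Rightarrow> nat \<Rightarrow> (real^'s^'s) measure" where
  "wishart G m =
     distr (\<Pi>\<^sub>M i\<in>{1..m}. mvnormal G) borel (\<lambda>v. \<Sum>i\<in>{1..m}. outer_prod (v i))"

(* The columns of P are the basis vectors e_k with k in S, each occurring once.  The index type 's
   carries no order, so any enumeration of S is admitted; in particular CARD('s) = card S. *)
definition selection_matrix :: "'n::finite set \<Rightarrow> real^'s^'n \<Rightarrow> bool" where
  "selection_matrix S P \<longleftrightarrow>
     (\<exists>\<sigma>. bij_betw \<sigma> (UNIV :: 's set) S \<and> (\<forall>j. column j P = axis (\<sigma> j) 1))"

end

theory Submission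
  imports Defs
begin

text \<open>
  Selecting coordinates commutes with forming outer products:
  \<open>P\<^sup>T (\<Sum>\<^sub>i u\<^sub>i u\<^sub>i\<^sup>T) P = \<Sum>\<^sub>i w\<^sub>i w\<^sub>i\<^sup>T\<close> with \<open>w\<^sub>i = P\<^sup>T u\<^sub>i\<close>. The vectors \<open>w\<^sub>i\<close> are again
  independent, so everything follows from two facts about them.

  The first is that \<open>w\<^sub>i\<close> has law \<open>N(0, P\<^sup>T \<Sigma> P)\<close> (\<open>distr_mvnormal_selection\<close>); with independence
  this gives the joint law of the \<open>w\<^sub>i\<close> and hence the Wishart law of the sum. Instead of
  integrating out the other coordinates of the density, the proof writes \<open>N(0, \<Sigma>)\<close> as the image
  of the standard Gaussian under a matrix \<open>A\<close> with \<open>A A\<^sup>T = \<Sigma>\<close> (\<open>distr_mvnormal_one\<close>), where \<open>A\<close>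
  is adapted to \<open>S\<close>: it satisfies \<open>P\<^sup>T A = C P\<^sup>T\<close> for an invertible \<open>C\<close> with
  \<open>C C\<^sup>T = P\<^sup>T \<Sigma> P\<close> (\<open>compatible_factorization\<close>). Such an \<open>A\<close> is a block version of the Cholesky
  factor and comes from Gram-Schmidt started in the coordinate subspace of \<open>S\<close>. The question is
  thereby reduced to the marginals of the standard Gaussian, which is a product measure.

  The second is that \<open>s\<close> independent vectors in \<open>s\<close>-dimensional space whose common law does not charge
  hyperplanes through the origin are almost surely a basis (\<open>AE_det_rows_nonzero\<close>). As
  \<open>s \<le> m\<close>, the \<open>w\<^sub>i\<close> then span the whole space, and a sum of outer products of spanning vectors
  is positive definite, in particular invertible (\<open>invertible_sum_outer_prod\<close>). The bound on the
  rank of the full matrix holds pointwise, because its range lies in the span of \<open>m\<close> vectors.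
\<close>

section \<open>Linear changes of variables for Lebesgue measure\<close>

lemma prod_Basis_vec:
  "(\<Prod>b\<in>(Basis :: (real^'n) set). g b) = (\<Prod>i\<in>UNIV. g (axis i 1))"
proof -
  have eq: "(Basis :: (real^'n) set) = range (\<lambda>i. axis i 1)"
    by (auto simp: Basis_vec_def)
  have "inj (\<lambda>i::'n. axis i (1::real))"
    by (auto simp: inj_on_def axis_eq_axis)
  then show ?thesis
    unfolding eq by (subst prod.reindex) (simp_all add: o_def)
qed

lemma measurable_vec_lambda:
  assumes "\<And>i. sets (N i) = sets borel"
  shows "vec_lambda \<in> measurable (Pi\<^sub>M (UNIV::'n::finite set) N) (borel :: (real^'n) measure)"
proof (subst borel_measurable_euclidean_space, rule ballI)
  fix b :: "real^'n" assume "b \<in> Basis"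
  then obtain i where b: "b = axis i 1" by (auto simp: Basis_vec_def)
  have "(\<lambda>x. x i) \<in> measurable (Pi\<^sub>M UNIV N) (N i)"
    by (rule measurable_component_singleton) simp
  then have "(\<lambda>x. x i) \<in> borel_measurable (Pi\<^sub>M UNIV N)"
    using measurable_cong_sets[OF refl assms] by blast
  then show "(\<lambda>x. vec_lambda x \<bullet> b) \<in> borel_measurable (Pi\<^sub>M UNIV N)"
    by (simp add: b inner_axis)
qed

lemma measurable_vec_lambda_lborel [measurable]:
  "vec_lambda \<in> measurable (\<Pi>\<^sub>M i\<in>(UNIV::'n::finite set). (lborel :: real measure)) borel"
  by (rule measurable_vec_lambda) simp

text \<open>
  Both sides give a box the product of its side lengths. With this description of Lebesgue
  measure a single coordinate can be split off by Fubini.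
\<close>
lemma lborel_eq_distr_PiM_vec:
  "(lborel :: (real^'n) measure) = distr (\<Pi>\<^sub>M i\<in>(UNIV::'n set). lborel) borel vec_lambda"
proof (rule lborel_eqI)
  interpret product_sigma_finite "\<lambda>_::'n. lborel :: real measure" by standard
  fix l u :: "real^'n"
  assume le: "\<And>b. b \<in> Basis \<Longrightarrow> l \<bullet> b \<le> u \<bullet> b"
  then have le': "l $ i \<le> u $ i" for i
    using le[of "axis i 1"] by (auto simp: Basis_vec_def inner_axis)
  have pre: "vec_lambda -` box l u \<inter> space (\<Pi>\<^sub>M i\<in>(UNIV::'n set). (lborel :: real measure))
      = (\<Pi>\<^sub>E i\<in>UNIV. {l $ i <..< u $ i})"
    by (auto simp: space_PiM mem_box_cart PiE_def Pi_def)
  have "emeasure (distr (\<Pi>\<^sub>M i\<in>(UNIV::'n set). lborel) borel vec_lambda) (box l u)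
      = (\<Prod>i\<in>(UNIV::'n set). ennreal (u $ i - l $ i))"
    by (subst emeasure_distr) (auto simp: pre emeasure_PiM le')
  also have "\<dots> = ennreal (\<Prod>i\<in>(UNIV::'n set). u $ i - l $ i)"
    by (rule prod_ennreal) (simp add: le')
  also have "(\<Prod>i\<in>(UNIV::'n set). u $ i - l $ i) = (\<Prod>b\<in>Basis. (u - l) \<bullet> b)"
    by (simp add: prod_Basis_vec inner_axis)
  finally show "emeasure (distr (\<Pi>\<^sub>M i\<in>(UNIV::'n set). lborel) borel vec_lambda) (box l u)
      = (\<Prod>b\<in>Basis. (u - l) \<bullet> b)" .
qed simp

lemma measurable_vec_nth [measurable]: "(\<lambda>x::real^'n. x $ i) \<in> borel_measurable borel"
  by (intro borel_measurable_continuous_onI continuous_intros)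

lemma measurable_matrix_vector [measurable]:
  fixes A :: "real^'n^'m"
  shows "(*v) A \<in> borel_measurable borel"
  by (intro borel_measurable_continuous_onI matrix_vector_mult_linear_continuous_on)

text \<open>
  Once the other coordinates are fixed, a shear merely translates the coordinate \<open>k\<close>.
\<close>
lemma nn_integral_lborel_shear:
  fixes f :: "real^'n \<Rightarrow> ennreal" and c :: real
  assumes [measurable]: "f \<in> borel_measurable borel" and "k \<noteq> l"
  shows "(\<integral>\<^sup>+x. f (\<chi> i. if i = k then x $ k + c * x $ l else x $ i) \<partial>lborel) = (\<integral>\<^sup>+x. f x \<partial>lborel)"
proof -
  interpret product_sigma_finite "\<lambda>_::'n. lborel :: real measure" by standard
  let ?I = "UNIV - {k} :: 'n set"
  have U: "UNIV = insert k ?I" by auto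
  have meas: "(\<lambda>x::real^'n. (\<chi> i. if i = k then x $ k + c * x $ l else x $ i) :: real^'n) \<in> borel_measurable borel"
  proof (intro borel_measurable_continuous_onI continuous_on_vec_lambda)
    show "continuous_on UNIV (\<lambda>x::real^'n. if i = k then x $ k + c * x $ l else x $ i)" for i
      by (cases "i = k") (auto intro!: continuous_intros)
  qed
  have fubini: "(\<integral>\<^sup>+x. g x \<partial>lborel) =
      (\<integral>\<^sup>+x. (\<integral>\<^sup>+y. g (vec_lambda (x(k := y))) \<partial>lborel) \<partial>(\<Pi>\<^sub>M i\<in>?I. lborel))"
    if g [measurable]: "g \<in> borel_measurable borel" for g :: "real^'n \<Rightarrow> ennreal"
  proof -
    have "(\<integral>\<^sup>+x. g x \<partial>lborel) = (\<integral>\<^sup>+x. g (vec_lambda x) \<partial>(\<Pi>\<^sub>M i\<in>(UNIV::'n set). lborel))"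
      by (subst lborel_eq_distr_PiM_vec) (simp add: nn_integral_distr)
    also have "\<dots> = (\<integral>\<^sup>+x. (\<integral>\<^sup>+y. g (vec_lambda (x(k := y))) \<partial>lborel) \<partial>(\<Pi>\<^sub>M i\<in>?I. lborel))"
    proof -
      have "(\<lambda>x. g (vec_lambda x)) \<in> borel_measurable (\<Pi>\<^sub>M i\<in>insert k ?I. lborel)"
        unfolding U[symmetric] by measurable
      from product_nn_integral_insert[OF _ _ this] show ?thesis
        unfolding U[symmetric] by simp
    qed
    finally show ?thesis .
  qed
  \<comment> \<open>on a line parallel to the axis \<open>k\<close>, the amount \<open>c * x l\<close> of the translation is constant\<close>
  have slice: "(\<integral>\<^sup>+y. f (\<chi> i. if i = k then vec_lambda (x(k := y)) $ k + c * vec_lambda (x(k := y)) $ l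
        else vec_lambda (x(k := y)) $ i) \<partial>lborel)
      = (\<integral>\<^sup>+y. f (vec_lambda (x(k := y))) \<partial>lborel)" for x :: "'n \<Rightarrow> real"
  proof -
    let ?h = "\<lambda>y. f (vec_lambda (x(k := y)))"
    have "continuous_on UNIV (\<lambda>y. vec_lambda (x(k := y)) :: real^'n)"
    proof (intro continuous_on_vec_lambda)
      show "continuous_on UNIV (\<lambda>y. (x(k := y)) i)" for i
        by (cases "i = k") auto
    qed
    then have [measurable]: "(\<lambda>y. vec_lambda (x(k := y)) :: real^'n) \<in> borel_measurable borel"
      by (rule borel_measurable_continuous_onI)
    have "(\<integral>\<^sup>+y. ?h y \<partial>lborel) = (\<integral>\<^sup>+y. ?h (c * x l + 1 * y) \<partial>lborel)"
      using nn_integral_real_affine[of ?h 1 "c * x l"] by simp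
    also have "(\<lambda>y. ?h (c * x l + 1 * y)) = (\<lambda>y. f (\<chi> i. if i = k
        then vec_lambda (x(k := y)) $ k + c * vec_lambda (x(k := y)) $ l
        else vec_lambda (x(k := y)) $ i))"
      using \<open>k \<noteq> l\<close> by (intro ext arg_cong[where f=f]) (auto simp: vec_eq_iff)
    finally show ?thesis ..
  qed
  show ?thesis
    unfolding fubini[OF measurable_compose[OF meas assms(1)]] fubini[OF assms(1)] slice ..
qed

text \<open>
  Exchanging two coordinates permutes the side lengths of a box.
\<close>
lemma distr_lborel_transpose:
  "distr lborel borel (\<lambda>x::real^'n. \<chi> i. x $ Transposition.transpose k l i) = lborel"
    (is "distr lborel borel ?T = _")
proof (rule lborel_eqI[symmetric])
  let ?\<tau> = "Transposition.transpose k l"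
  have meas [measurable]: "?T \<in> borel_measurable borel"
    by (intro borel_measurable_continuous_onI continuous_on_vec_lambda continuous_intros)
  fix a b :: "real^'n"
  assume le: "\<And>j. j \<in> Basis \<Longrightarrow> a \<bullet> j \<le> b \<bullet> j"
  then have le': "a $ i \<le> b $ i" for i
    using le[of "axis i 1"] by (auto simp: Basis_vec_def inner_axis)
  have pre: "?T -` box a b = box (?T a) (?T b)"
  proof (intro set_eqI iffI)
    fix x assume "x \<in> ?T -` box a b"
    then have *: "a $ i < x $ ?\<tau> i \<and> x $ ?\<tau> i < b $ i" for i
      by (simp add: mem_box_cart)
    show "x \<in> box (?T a) (?T b)"
      using *[of "?\<tau> i" for i] by (simp add: mem_box_cart)
  next
    fix x assume "x \<in> box (?T a) (?T b)"
    then have *: "a $ ?\<tau> i < x $ i \<and> x $ i < b $ ?\<tau> i" for i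
      by (simp add: mem_box_cart)
    show "x \<in> ?T -` box a b"
      using *[of "?\<tau> i" for i] by (simp add: mem_box_cart)
  qed
  have "emeasure (distr lborel borel ?T) (box a b) = (\<Prod>j\<in>Basis. (?T b - ?T a) \<bullet> j)"
  proof (subst emeasure_distr)
    have "0 \<le> (?T b - ?T a) \<bullet> j" if "j \<in> Basis" for j
      using that by (auto simp: Basis_vec_def inner_axis le')
    then show "emeasure lborel (?T -` box a b \<inter> space lborel) = (\<Prod>j\<in>Basis. (?T b - ?T a) \<bullet> j)"
      unfolding pre space_lborel space_borel Int_UNIV_right by (intro emeasure_lborel_box) (simp add: inner_diff_left)
  qed simp_all
  also have "(\<Prod>j\<in>Basis. (?T b - ?T a) \<bullet> j) = (\<Prod>i\<in>UNIV. (b - a) $ ?\<tau> i)"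
    by (simp add: prod_Basis_vec inner_axis)
  also have "\<dots> = (\<Prod>i\<in>UNIV. (b - a) $ i)"
    using prod.permute[OF permutes_swap_id, of k UNIV l "\<lambda>i. (b - a) $ i"] by (simp add: o_def)
  also have "\<dots> = (\<Prod>j\<in>Basis. (b - a) \<bullet> j)"
    by (simp add: prod_Basis_vec inner_axis)
  finally show "emeasure (distr lborel borel ?T) (box a b) = (\<Prod>j\<in>Basis. (b - a) \<bullet> j)" .
qed simp

text \<open>
  Both the formula and the determinant are multiplicative, and every matrix is a product of
  elementary ones, up to factors with a zero row (which the hypothesis on the determinant rules
  out). What remains are diagonal matrices, exchanges of coordinates and shears.
\<close>
lemma nn_integral_lborel_linear:
  fixes A :: "real^'n^'n" and f :: "real^'n \<Rightarrow> ennreal"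
  assumes "det A \<noteq> 0" "f \<in> borel_measurable borel"
  shows "(\<integral>\<^sup>+x. f x \<partial>lborel) = ennreal \<bar>det A\<bar> * (\<integral>\<^sup>+x. f (A *v x) \<partial>lborel)"
  using assms
proof (induction A arbitrary: f rule: induct_matrix_elementary)
  case (1 A B)
  have nz: "det A \<noteq> 0" "det B \<noteq> 0" using 1(3) by (auto simp: det_mul)
  note 1(4)[measurable]
  have "(\<integral>\<^sup>+x. f x \<partial>lborel) = ennreal \<bar>det A\<bar> * (\<integral>\<^sup>+x. f (A *v x) \<partial>lborel)"
    by (rule 1(1)[OF nz(1) 1(4)])
  also have "(\<integral>\<^sup>+x. f (A *v x) \<partial>lborel) = ennreal \<bar>det B\<bar> * (\<integral>\<^sup>+x. f (A *v (B *v x)) \<partial>lborel)"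
    by (rule 1(2)[OF nz(2)]) measurable
  finally show ?case
    by (simp add: det_mul abs_mult ennreal_mult' mult.assoc matrix_vector_mul_assoc)
next
  case (2 A i)
  then show ?case by (simp add: det_zero_row)
next
  case (3 A)
  note 3(3)[measurable]
  have det: "det A = (\<Prod>i\<in>UNIV. A $ i $ i)"
    by (rule det_diagonal) (use 3 in auto)
  then have nz: "A $ i $ i \<noteq> 0" for i using 3 by auto
  have A: "(A *v x) $ i = A $ i $ i * x $ i" for x i
  proof -
    have "(A *v x) $ i = (\<Sum>j\<in>{i}. A $ i $ j * x $ j)"
      unfolding matrix_vector_mult_def vec_lambda_beta
      by (rule sum.mono_neutral_right) (use 3(1) in auto)
    then show ?thesis by simp
  qed
  \<comment> \<open>the diagonal entries, indexed by the vectors of the standard basis\<close>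
  define c :: "real^'n \<Rightarrow> real" where "c b = b \<bullet> (A *v b)" for b
  have c [simp]: "c (axis i 1) = A $ i $ i" for i
    by (simp add: c_def inner_axis' A)
  have T: "A *v x = 0 + (\<Sum>j\<in>Basis. (c j * (x \<bullet> j)) *\<^sub>R j)" for x
  proof (rule euclidean_eqI)
    fix b :: "real^'n" assume b: "b \<in> Basis"
    then obtain i where "b = axis i 1" by (auto simp: Basis_vec_def)
    then have "(A *v x) \<bullet> b = c b * (x \<bullet> b)" by (simp add: inner_axis A)
    then show "(A *v x) \<bullet> b = (0 + (\<Sum>j\<in>Basis. (c j * (x \<bullet> j)) *\<^sub>R j)) \<bullet> b"
      using b by (simp add: inner_sum_left_Basis)
  qed
  have nz': "c j \<noteq> 0" if "j \<in> Basis" for j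
    using that nz by (auto simp: Basis_vec_def)
  have prod_c: "(\<Prod>j\<in>Basis. \<bar>c j\<bar>) = \<bar>det A\<bar>"
    by (simp add: prod_Basis_vec det abs_prod)
  have "lborel = density (distr lborel borel ((*v) A)) (\<lambda>_. ennreal \<bar>det A\<bar>)"
    using lborel_affine_euclidean[of c 0, OF nz'] unfolding prod_c T[symmetric] .
  then have "(\<integral>\<^sup>+x. f x \<partial>lborel) = (\<integral>\<^sup>+x. f x \<partial>density (distr lborel borel ((*v) A)) (\<lambda>_. ennreal \<bar>det A\<bar>))"
    by (rule arg_cong)
  also have "\<dots> = ennreal \<bar>det A\<bar> * (\<integral>\<^sup>+x. f (A *v x) \<partial>lborel)"
    by (simp add: nn_integral_density nn_integral_distr nn_integral_cmult)
  finally show ?case .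
next
  case (4 k l)
  note 4(3)[measurable]
  let ?\<tau> = "Transposition.transpose k l"
  let ?T = "\<lambda>x::real^'n. (\<chi> i. x $ ?\<tau> i)"
  have meas [measurable]: "?T \<in> borel_measurable borel"
    by (intro borel_measurable_continuous_onI continuous_on_vec_lambda continuous_intros)
  have A: "(\<chi> i j. mat 1 $ i $ ?\<tau> j) *v x = ?T x" for x :: "real^'n"
  proof (subst vec_eq_iff, rule allI)
    fix i
    have swap: "i = ?\<tau> j \<longleftrightarrow> j = ?\<tau> i" for j
      by (metis transpose_involutory)
    have "((\<chi> i j. mat 1 $ i $ ?\<tau> j) *v x) $ i = (\<Sum>j\<in>UNIV. if j = ?\<tau> i then x $ j else 0)"
      unfolding matrix_vector_mult_def vec_lambda_beta mat_def swap
      by (intro sum.cong) auto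
    then show "((\<chi> i j. mat 1 $ i $ ?\<tau> j) *v x) $ i = ?T x $ i" by simp
  qed
  have "\<bar>det ((\<chi> i j. mat 1 $ i $ ?\<tau> j) :: real^'n^'n)\<bar> = 1"
    by (simp add: det_permute_columns permutes_swap_id sign_swap_id abs_mult)
  moreover have "(\<integral>\<^sup>+x. f x \<partial>lborel) = (\<integral>\<^sup>+x. f (?T x) \<partial>lborel)"
    using nn_integral_distr[of ?T lborel borel f] by (simp add: distr_lborel_transpose)
  ultimately show ?case by (simp add: A)
next
  case (5 k l c)
  let ?E = "(\<chi> i j. if i = k \<and> j = l then c else of_bool (i = j)) :: real^'n^'n"
  have "?E = (\<chi> i. if i = k then row k (mat 1) + c *s row l (mat 1) else row i (mat 1))"
    using 5(1) by (auto simp: vec_eq_iff row_def mat_def)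
  then have "det ?E = 1"
    using det_row_operation[OF 5(1), of "mat 1 :: real^'n^'n" c] by simp
  moreover have "?E *v x = (\<chi> i. if i = k then x $ k + c * x $ l else x $ i)" for x
  proof (subst vec_eq_iff, rule allI)
    fix i
    have "(?E *v x) $ i = (\<Sum>j\<in>UNIV. (if j = i then x $ j else 0) + (if j = l then if i = k then c * x $ j else 0 else 0))"
      unfolding matrix_vector_mult_def
      using 5(1) by (auto intro!: sum.cong)
    also have "\<dots> = x $ i + (if i = k then c * x $ l else 0)"
      by (subst sum.distrib) simp
    finally show "(?E *v x) $ i = (\<chi> i. if i = k then x $ k + c * x $ l else x $ i) $ i" by simp
  qed
  ultimately show ?case
    using nn_integral_lborel_shear[OF 5(3,1), of c] by simp
qed

section \<open>Gaussian measures as linear images of the standard one\<close>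

lemma inner_matrix_vector_eq_transpose:
  fixes A :: "real^'n^'m"
  shows "x \<bullet> (A *v y) = (transpose A *v x) \<bullet> y"
  by (simp add: dot_lmul_matrix)

lemma matrix_inv_cancel:
  fixes A :: "real^'n^'n"
  assumes "invertible A"
  shows "A *v (matrix_inv A *v x) = x" "matrix_inv A *v (A *v x) = x"
proof -
  obtain B where B: "A ** B = mat 1" "B ** A = mat 1"
    using assms unfolding invertible_def by blast
  have "A ** matrix_inv A = mat 1 \<and> matrix_inv A ** A = mat 1"
    unfolding matrix_inv_def by (rule someI[where x = B]) (use B in blast)
  then show "A *v (matrix_inv A *v x) = x" "matrix_inv A *v (A *v x) = x"
    by (simp_all add: matrix_vector_mul_assoc)
qed

text \<open>
  The substitution \<open>y = A x\<close> turns the quadratic form of \<open>(A A\<^sup>T)\<^sup>-\<^sup>1\<close> into the standard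
  one, and the normalising constants differ by \<open>\<bar>det A\<bar>\<close>, the square root of \<open>det (A A\<^sup>T)\<close>.
\<close>
lemma mvnormal_density_linear:
  fixes A :: "real^'n^'n"
  assumes "invertible A"
  shows "mvnormal_density (mat 1) x = \<bar>det A\<bar> * mvnormal_density (A ** transpose A) (A *v x)"
proof -
  let ?G = "A ** transpose A"
  have d: "det A \<noteq> 0" using assms by (simp add: invertible_det_nz)
  then have "invertible ?G" "invertible (transpose A)" by (simp_all add: invertible_det_nz det_mul)
  note inv = matrix_inv_cancel[OF this(1)] matrix_inv_cancel[OF this(2)]
  let ?y = "matrix_inv (transpose A) *v x"
  have "?G *v ?y = A *v x"
    by (simp add: matrix_vector_mul_assoc[symmetric] inv del: transpose_matrix_vector)
  then have y: "matrix_inv ?G *v (A *v x) = ?y"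
    using inv(2)[of ?y] by metis
  have "(A *v x) \<bullet> ?y = x \<bullet> (transpose A *v ?y)"
    by (metis inner_commute inner_matrix_vector_eq_transpose)
  then have quad: "(A *v x) \<bullet> (matrix_inv ?G *v (A *v x)) = x \<bullet> x"
    by (simp add: y inv del: transpose_matrix_vector)
  have I: "matrix_inv (mat 1 :: real^'n^'n) *v x = x"
    using matrix_inv_cancel(1)[of "mat 1 :: real^'n^'n" x] by (simp add: invertible_det_nz)
  have "sqrt ((2 * pi) ^ CARD('n) * det ?G) = sqrt ((2 * pi) ^ CARD('n)) * \<bar>det A\<bar>"
    by (simp add: det_mul real_sqrt_mult power2_eq_square[symmetric] det_transpose)
  then show ?thesis
    using d by (simp add: mvnormal_density_def quad I)
qed

lemma borel_measurable_mvnormal_density [measurable]: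
  "mvnormal_density A \<in> borel_measurable borel"
proof -
  have "continuous_on UNIV (\<lambda>x. x \<bullet> (matrix_inv A *v x))"
    by (intro continuous_intros)
  then have "(\<lambda>x. x \<bullet> (matrix_inv A *v x)) \<in> borel_measurable borel"
    by (rule borel_measurable_continuous_onI)
  then show ?thesis unfolding mvnormal_density_def[abs_def] by measurable
qed

lemma sets_mvnormal [simp, measurable_cong]: "sets (mvnormal A) = sets borel"
  by (simp add: mvnormal_def)

lemma space_mvnormal [simp]: "space (mvnormal A) = UNIV"
  by (simp add: mvnormal_def)

text \<open>
  Hence \<open>N(0, A A\<^sup>T)\<close> can be handled as the law of \<open>A z\<close> with \<open>z\<close> standard, and linear images of
  Gaussian measures reduce to products of matrices.
\<close>
lemma distr_mvnormal_one:
  fixes A :: "real^'n^'n"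
  assumes "invertible A"
  shows "distr (mvnormal (mat 1)) borel ((*v) A) = mvnormal (A ** transpose A)"
proof (rule measure_eqI)
  fix X assume "X \<in> sets (distr (mvnormal (mat 1)) borel ((*v) A))"
  then have X [measurable]: "X \<in> sets borel" by simp
  let ?g = "\<lambda>y. ennreal (mvnormal_density (A ** transpose A) y) * indicator X y"
  have pre: "(*v) A -` X \<in> sets borel"
    by (rule measurable_sets_borel[OF measurable_matrix_vector X])
  have "emeasure (distr (mvnormal (mat 1)) borel ((*v) A)) X
      = (\<integral>\<^sup>+x. ennreal (mvnormal_density (mat 1) x) * indicator ((*v) A -` X) x \<partial>lborel)"
    using pre by (subst emeasure_distr) (simp_all add: mvnormal_def emeasure_density)
  also have "\<dots> = (\<integral>\<^sup>+x. ennreal \<bar>det A\<bar> * ?g (A *v x) \<partial>lborel)"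
    by (intro nn_integral_cong)
       (auto simp: mvnormal_density_linear[OF assms] ennreal_mult' indicator_def)
  also have "\<dots> = ennreal \<bar>det A\<bar> * (\<integral>\<^sup>+x. ?g (A *v x) \<partial>lborel)"
    by (rule nn_integral_cmult) measurable
  also have "\<dots> = (\<integral>\<^sup>+y. ?g y \<partial>lborel)"
    using assms by (subst nn_integral_lborel_linear[of A]) (auto simp: invertible_det_nz)
  also have "\<dots> = emeasure (mvnormal (A ** transpose A)) X"
    by (simp add: mvnormal_def emeasure_density)
  finally show "emeasure (distr (mvnormal (mat 1)) borel ((*v) A)) X = emeasure (mvnormal (A ** transpose A)) X" .
qed simp

text \<open>
  Independence of coordinates in terms of densities; used to identify the standard Gaussian
  with a product of one-dimensional ones.
\<close>
lemma density_PiM: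
  fixes N :: "'i \<Rightarrow> 'b measure" and f :: "'i \<Rightarrow> 'b \<Rightarrow> ennreal"
  assumes "finite I" "product_sigma_finite N" "product_sigma_finite (\<lambda>i. density (N i) (f i))"
    and f [measurable]: "\<And>i. i \<in> I \<Longrightarrow> f i \<in> borel_measurable (N i)"
  shows "density (\<Pi>\<^sub>M i\<in>I. N i) (\<lambda>x. \<Prod>i\<in>I. f i (x i)) = (\<Pi>\<^sub>M i\<in>I. density (N i) (f i))"
proof (rule product_sigma_finite.PiM_eqI[OF assms(3,1)])
  show "sets (density (Pi\<^sub>M I N) (\<lambda>x. \<Prod>i\<in>I. f i (x i))) = sets (\<Pi>\<^sub>M i\<in>I. density (N i) (f i))"
    by (simp cong: sets_PiM_cong)
  fix A assume "\<And>i. i \<in> I \<Longrightarrow> A i \<in> sets (density (N i) (f i))"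
  then have A [measurable]: "i \<in> I \<Longrightarrow> A i \<in> sets (N i)" for i by simp
  have AP: "Pi\<^sub>E I A \<in> sets (Pi\<^sub>M I N)"
    using A \<open>finite I\<close> by (intro sets_PiM_I_finite) auto
  have prod_meas: "(\<lambda>x. \<Prod>i\<in>I. f i (x i)) \<in> borel_measurable (Pi\<^sub>M I N)"
  proof (intro borel_measurable_prod_ennreal)
    fix i assume i: "i \<in> I"
    show "(\<lambda>x. f i (x i)) \<in> borel_measurable (Pi\<^sub>M I N)"
      by (rule measurable_compose[OF measurable_component_singleton[OF i, where M = N] f[OF i]])
  qed
  have "emeasure (density (Pi\<^sub>M I N) (\<lambda>x. \<Prod>i\<in>I. f i (x i))) (Pi\<^sub>E I A)
      = (\<integral>\<^sup>+x. (\<Prod>i\<in>I. f i (x i)) * indicator (Pi\<^sub>E I A) x \<partial>Pi\<^sub>M I N)"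
    by (rule emeasure_density[OF prod_meas AP])
  also have "\<dots> = (\<integral>\<^sup>+x. (\<Prod>i\<in>I. f i (x i) * indicator (A i) (x i)) \<partial>Pi\<^sub>M I N)"
  proof (rule nn_integral_cong)
    fix x assume "x \<in> space (Pi\<^sub>M I N)"
    then have ext: "x \<in> extensional I" by (simp add: space_PiM PiE_def)
    show "(\<Prod>i\<in>I. f i (x i)) * indicator (Pi\<^sub>E I A) x = (\<Prod>i\<in>I. f i (x i) * indicator (A i) (x i))"
    proof (cases "x \<in> Pi\<^sub>E I A")
      case True
      then show ?thesis by (auto intro!: prod.cong simp: PiE_mem)
    next
      case False
      then obtain i where "i \<in> I" "x i \<notin> A i" using ext by (auto simp: PiE_def)
      then have "(\<Prod>i\<in>I. f i (x i) * indicator (A i) (x i)) = 0"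
        using \<open>finite I\<close> by (intro prod_zero bexI[of _ i]) auto
      then show ?thesis using False by simp
    qed
  qed
  also have "\<dots> = (\<Prod>i\<in>I. \<integral>\<^sup>+x. f i x * indicator (A i) x \<partial>N i)"
    by (rule product_sigma_finite.product_nn_integral_prod[OF assms(2,1)]) measurable
  also have "\<dots> = (\<Prod>i\<in>I. emeasure (density (N i) (f i)) (A i))"
    by (intro prod.cong) (auto simp: emeasure_density)
  finally show "emeasure (density (Pi\<^sub>M I N) (\<lambda>x. \<Prod>i\<in>I. f i (x i))) (Pi\<^sub>E I A)
      = (\<Prod>i\<in>I. emeasure (density (N i) (f i)) (A i))" .
qed

text \<open>
  The exponential of a sum of squares factorises. Reading the standard Gaussian as a product
  measure makes its coordinate marginals evident.
\<close>
lemma mvnormal_one_eq_distr_PiM: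
  "mvnormal (mat 1 :: real^'n^'n)
     = distr (\<Pi>\<^sub>M i\<in>(UNIV::'n set). density lborel std_normal_density) borel vec_lambda"
proof -
  interpret N: prob_space "density lborel std_normal_density"
    by (rule prob_space_normal_density) simp
  have sf: "product_sigma_finite (\<lambda>_::'n. density lborel std_normal_density)"
    by standard
  have sf': "product_sigma_finite (\<lambda>_::'n. lborel :: real measure)"
    by standard
  have dens: "mvnormal_density (mat 1) (vec_lambda x) = (\<Prod>i\<in>UNIV. std_normal_density (x i))" for x :: "'n \<Rightarrow> real"
  proof -
    have I: "matrix_inv (mat 1 :: real^'n^'n) *v y = y" for y
      using matrix_inv_cancel(1)[of "mat 1 :: real^'n^'n" y] by (simp add: invertible_det_nz)
    have "(\<Prod>i\<in>UNIV. std_normal_density (x i))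
        = (\<Prod>i\<in>(UNIV::'n set). 1 / sqrt (2 * pi)) * exp (\<Sum>i\<in>UNIV. - (x i)\<^sup>2 / 2)"
      by (simp add: std_normal_density_def prod.distrib exp_sum prod_dividef power_divide)
    also have "(\<Prod>i\<in>(UNIV::'n set). 1 / sqrt (2 * pi)) = 1 / sqrt ((2 * pi) ^ CARD('n))"
      by (simp only: prod_constant power_one_over real_sqrt_power)
    also have "(\<Sum>i\<in>UNIV. - (x i)\<^sup>2 / 2) = - (vec_lambda x \<bullet> vec_lambda x) / 2"
      by (simp add: inner_vec_def power2_eq_square sum_negf sum_divide_distrib)
    finally show ?thesis by (simp add: mvnormal_density_def I)
  qed
  have "mvnormal (mat 1 :: real^'n^'n)
      = density (distr (\<Pi>\<^sub>M i\<in>(UNIV::'n set). lborel) borel vec_lambda) (\<lambda>x. ennreal (mvnormal_density (mat 1) x))"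
    unfolding mvnormal_def using lborel_eq_distr_PiM_vec[where 'n='n] by (rule arg_cong)
  also have "\<dots> = distr (density (\<Pi>\<^sub>M i\<in>(UNIV::'n set). lborel)
      (\<lambda>x. ennreal (mvnormal_density (mat 1) (vec_lambda x :: real^'n)))) borel vec_lambda"
    by (rule density_distr) measurable
  also have "(\<lambda>x. ennreal (mvnormal_density (mat 1) (vec_lambda x :: real^'n)))
      = (\<lambda>x. \<Prod>i\<in>UNIV. ennreal (std_normal_density (x i)))"
    by (simp add: dens prod_ennreal)
  also have "density (\<Pi>\<^sub>M i\<in>(UNIV::'n set). lborel) (\<lambda>x. \<Prod>i\<in>UNIV. ennreal (std_normal_density (x i)))
      = (\<Pi>\<^sub>M i\<in>(UNIV::'n set). density lborel std_normal_density)"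
    using density_PiM[OF finite sf' sf] by simp
  finally show ?thesis .
qed

section \<open>Orthonormal bases adapted to a coordinate subspace\<close>

text \<open>
  Gram-Schmidt for the inner product \<open>x \<bullet> (\<Sigma> *v y)\<close>. It is phrased as an extension of vectors
  that are already orthonormal on an index set \<open>S\<close>, so that the resulting basis can be made to
  start with a basis of a prescribed subspace.
\<close>
lemma form_orthonormal_extend:
  fixes \<Sigma> :: "real^'n^'n" and b :: "'n \<Rightarrow> real^'n"
  assumes pd: "positive_definite \<Sigma>"
    and b: "\<And>i j. i \<in> S \<Longrightarrow> j \<in> S \<Longrightarrow> b i \<bullet> (\<Sigma> *v b j) = of_bool (i = j)"
  obtains e where "\<And>i. i \<in> S \<Longrightarrow> e i = b i" "\<And>i j. e i \<bullet> (\<Sigma> *v e j) = of_bool (i = j)"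
proof -
  have sym: "x \<bullet> (\<Sigma> *v y) = y \<bullet> (\<Sigma> *v x)" for x y
    using pd by (metis inner_commute inner_matrix_vector_eq_transpose positive_definite_def)
  have "\<exists>e. (\<forall>i\<in>S. e i = b i) \<and> (\<forall>i\<in>S \<union> T. \<forall>j\<in>S \<union> T. e i \<bullet> (\<Sigma> *v e j) = of_bool (i = j))"
    if "finite T" for T
    using that
  proof (induction T rule: finite_induct)
    case empty
    then show ?case using b by (intro exI[of _ b]) auto
  next
    case (insert k T)
    then obtain e where eb: "\<forall>i\<in>S. e i = b i"
      and e: "\<And>i j. i \<in> S \<union> T \<Longrightarrow> j \<in> S \<union> T \<Longrightarrow> e i \<bullet> (\<Sigma> *v e j) = of_bool (i = j)" by metis
    show ?case
    proof (cases "k \<in> S \<union> T")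
      case True
      then have eq: "S \<union> insert k T = S \<union> T" by auto
      show ?thesis unfolding eq using eb e by blast
    next
      case False
      let ?J = "S \<union> T"
      have "dim (e ` ?J) \<le> card (e ` ?J)" by (rule dim_le_card') simp
      also have "\<dots> \<le> card ?J" by (rule card_image_le) simp
      also have "\<dots> < CARD('n)" using False by (intro psubset_card_mono) auto
      finally have "span (e ` ?J) \<noteq> UNIV" by (auto dest: dim_eq_full[THEN iffD2])
      then obtain x where x: "x \<notin> span (e ` ?J)" by auto
      define y where "y = x - (\<Sum>j\<in>?J. (x \<bullet> (\<Sigma> *v e j)) *\<^sub>R e j)"
      have "(\<Sum>j\<in>?J. (x \<bullet> (\<Sigma> *v e j)) *\<^sub>R e j) \<in> span (e ` ?J)"
        by (intro span_sum span_scale span_base) auto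
      then have "y \<noteq> 0" using x by (auto simp: y_def)
      then have pos: "y \<bullet> (\<Sigma> *v y) > 0" using pd by (simp add: positive_definite_def)
      have orth: "y \<bullet> (\<Sigma> *v e j) = 0" if "j \<in> ?J" for j
      proof -
        have "(\<Sum>i\<in>?J. (x \<bullet> (\<Sigma> *v e i)) *\<^sub>R e i) \<bullet> (\<Sigma> *v e j)
            = (\<Sum>i\<in>?J. (x \<bullet> (\<Sigma> *v e i)) * of_bool (i = j))"
          using e that by (simp add: inner_sum_left)
        also have "\<dots> = (\<Sum>i\<in>?J. if i = j then x \<bullet> (\<Sigma> *v e i) else 0)"
          by (intro sum.cong) auto
        also have "\<dots> = x \<bullet> (\<Sigma> *v e j)"
          using that by simp
        finally show ?thesis by (simp add: y_def inner_diff_left)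
      qed
      \<comment> \<open>\<open>y\<close> is the component of \<open>x\<close> that is \<open>\<Sigma>\<close>-orthogonal to the vectors chosen so far\<close>
      define z where "z = (1 / sqrt (y \<bullet> (\<Sigma> *v y))) *\<^sub>R y"
      have zz: "z \<bullet> (\<Sigma> *v z) = 1"
        using pos by (simp add: z_def matrix_vector_mult_scaleR)
      have ze: "z \<bullet> (\<Sigma> *v e j) = 0" if "j \<in> ?J" for j
        using orth[OF that] by (simp add: z_def)
      have "(e(k := z)) i \<bullet> (\<Sigma> *v (e(k := z)) j) = of_bool (i = j)"
        if "i \<in> S \<union> insert k T" "j \<in> S \<union> insert k T" for i j
        using that zz ze e False sym[of "e i" z] by auto
      moreover have "\<forall>i\<in>S. (e(k := z)) i = b i"
        using eb False by auto
      ultimately show ?thesis by blast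
    qed
  qed
  from this[of UNIV] show thesis using that by auto
qed

lemma positive_definite_compress:
  fixes \<Sigma> :: "real^'n^'n" and P :: "real^'s^'n"
  assumes pd: "positive_definite \<Sigma>" and inj: "\<And>x. P *v x = 0 \<Longrightarrow> x = 0"
  shows "positive_definite (transpose P ** \<Sigma> ** P)"
proof -
  have "x \<bullet> ((transpose P ** \<Sigma> ** P) *v x) = (P *v x) \<bullet> (\<Sigma> *v (P *v x))" for x
    by (simp add: matrix_vector_mul_assoc[symmetric] inner_matrix_vector_eq_transpose[of _ "transpose P"] del: transpose_matrix_vector)
  then show ?thesis
    using pd inj unfolding positive_definite_def
    by (auto simp: matrix_transpose_mul matrix_mul_assoc)
qed

lemma congruence_component:
  "(transpose B ** A ** B) $ i $ j = column i B \<bullet> (A *v column j B)"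
  for A :: "real^'n^'n" and B :: "real^'k^'n"
proof -
  have "(transpose B ** A ** B) $ i $ j = axis i 1 \<bullet> ((transpose B ** A ** B) *v axis j 1)"
    by (simp add: inner_axis' matrix_vector_mult_basis column_def)
  also have "\<dots> = (B *v axis i 1) \<bullet> (A *v (B *v axis j 1))"
    by (simp add: matrix_vector_mul_assoc[symmetric] inner_matrix_vector_eq_transpose[of _ "transpose B"] del: transpose_matrix_vector)
  finally show ?thesis by (simp add: matrix_vector_mult_basis)
qed

lemma transpose_selection_mult:
  fixes P :: "real^'s^'n"
  assumes "\<And>j. column j P = axis (\<sigma> j) 1"
  shows "(transpose P *v x) $ j = x $ \<sigma> j"
proof -
  have "(transpose P *v x) $ j = axis j 1 \<bullet> (transpose P *v x)"
    by (simp only: inner_axis') simp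
  also have "\<dots> = (P *v axis j 1) \<bullet> x"
    by (simp only: inner_matrix_vector_eq_transpose transpose_transpose)
  also have "P *v axis j 1 = axis (\<sigma> j) 1"
    by (simp add: matrix_vector_mult_basis assms)
  finally show ?thesis by (simp only: inner_axis') simp
qed

text \<open>
  Factorisations of \<open>\<Sigma>\<close> and of its principal submatrix that are intertwined by \<open>P\<^sup>T\<close>. They come
  from bases: if \<open>B\<close> has \<open>\<Sigma>\<close>-orthonormal columns, that is \<open>B\<^sup>T \<Sigma> B = 1\<close>, then \<open>A = (B\<^sup>T)\<^sup>-\<^sup>1\<close>
  satisfies \<open>A A\<^sup>T = \<Sigma>\<close>. Choose an orthonormal basis \<open>D\<close> for the submatrix, carry it by \<open>P\<close> into
  the coordinate subspace of \<open>S\<close>, and complete it to a \<open>\<Sigma>\<close>-orthonormal basis \<open>B\<close>, whose columns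
  at the indices in \<open>S\<close> are those of \<open>P D\<close>. Then \<open>B P = P D\<close>, and inverting and transposing
  this identity gives \<open>P\<^sup>T A = C P\<^sup>T\<close>.
\<close>
lemma compatible_factorization:
  fixes \<Sigma> :: "real^'n^'n" and P :: "real^'s^'n"
  assumes pd: "positive_definite \<Sigma>" and sel: "selection_matrix S P"
  obtains A C where "invertible A" "A ** transpose A = \<Sigma>"
    "invertible C" "C ** transpose C = transpose P ** \<Sigma> ** P" "transpose P ** A = C ** transpose P"
proof -
  obtain \<sigma> where bij: "bij_betw \<sigma> UNIV S" and col: "\<And>j. column j P = axis (\<sigma> j) 1"
    using sel unfolding selection_matrix_def by blast
  have Pax: "P *v axis j 1 = axis (\<sigma> j) 1" for j
    by (simp add: matrix_vector_mult_basis col)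
  have inj\<sigma>: "\<sigma> i = \<sigma> j \<longleftrightarrow> i = j" for i j
    using bij by (auto simp: bij_betw_def inj_on_def)
  have PtP: "transpose P *v (P *v x) = x" for x
  proof -
    have "(transpose P *v (P *v x)) $ j = x $ j" for j
    proof -
      have "P $ \<sigma> j $ k = of_bool (k = j)" for k
      proof -
        have "P $ \<sigma> j $ k = column k P $ \<sigma> j" by (simp add: column_def)
        then show ?thesis by (auto simp: col axis_def inj\<sigma>)
      qed
      then have "(P *v x) $ \<sigma> j = (\<Sum>k\<in>UNIV. if k = j then x $ k else 0)"
        unfolding matrix_vector_mult_def by (auto intro!: sum.cong)
      then show ?thesis by (simp add: transpose_selection_mult[OF col] del: transpose_matrix_vector)
    qed
    then show ?thesis by (simp add: vec_eq_iff)
  qed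
  let ?\<Gamma> = "transpose P ** \<Sigma> ** P"
  have pd\<Gamma>: "positive_definite ?\<Gamma>"
    by (rule positive_definite_compress[OF pd]) (metis PtP matrix_vector_mult_0_right)
  obtain d :: "'s \<Rightarrow> real^'s" where d: "\<And>i j. d i \<bullet> (?\<Gamma> *v d j) = of_bool (i = j)"
    using form_orthonormal_extend[OF pd\<Gamma>, of "{}"] by (metis empty_iff)
  define b where "b i = P *v d (inv_into UNIV \<sigma> i)" for i
  have b\<sigma>: "b (\<sigma> j) = P *v d j" for j
    using bij by (simp add: b_def bij_betw_def inv_into_f_f)
  have "b i \<bullet> (\<Sigma> *v b j) = of_bool (i = j)" if ij: "i \<in> S" "j \<in> S" for i j
  proof -
    obtain p q where pq: "i = \<sigma> p" "j = \<sigma> q"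
      using ij bij by (auto simp: bij_betw_def)
    have "b i \<bullet> (\<Sigma> *v b j) = d p \<bullet> (?\<Gamma> *v d q)"
      by (simp add: pq b\<sigma> matrix_vector_mul_assoc[symmetric] inner_matrix_vector_eq_transpose[of _ "transpose P"] del: transpose_matrix_vector)
    then show ?thesis by (simp add: d pq inj\<sigma>)
  qed
  then obtain e where eb: "\<And>i. i \<in> S \<Longrightarrow> e i = b i" and e: "\<And>i j. e i \<bullet> (\<Sigma> *v e j) = of_bool (i = j)"
    using form_orthonormal_extend[OF pd, of S b] by blast
  define B where "B = (\<chi> i j. e j $ i)"
  define D where "D = (\<chi> i j. d j $ i)"
  have colB: "column j B = e j" for j by (simp add: B_def column_def vec_eq_iff)
  have colD: "column j D = d j" for j by (simp add: D_def column_def vec_eq_iff)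
  have BB: "transpose B ** \<Sigma> ** B = mat 1"
    by (simp add: vec_eq_iff congruence_component colB e mat_def)
  have DD: "transpose D ** ?\<Gamma> ** D = mat 1"
    by (simp add: vec_eq_iff congruence_component colD d mat_def)
  have BP: "B ** P = P ** D"
  proof -
    have "(B ** P) *v axis j 1 = (P ** D) *v axis j 1" for j
    proof -
      have "\<sigma> j \<in> S" using bij by (auto simp: bij_betw_def)
      then have "e (\<sigma> j) = P *v d j" by (simp add: eb b\<sigma>)
      moreover have "B *v axis (\<sigma> j) 1 = e (\<sigma> j)" "D *v axis j 1 = d j"
        by (simp_all add: matrix_vector_mult_basis colB colD)
      ultimately show ?thesis
        by (simp only: matrix_vector_mul_assoc[symmetric] Pax)
    qed
    then have "column j (B ** P) = column j (P ** D)" for j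
      by (simp only: matrix_vector_mult_basis)
    then show ?thesis by (simp add: column_def vec_eq_iff)
  qed
  have factor: "\<exists>A. transpose A ** B = mat 1 \<and> B ** transpose A = mat 1 \<and> invertible A \<and> A ** transpose A = \<Sigma>"
    if "transpose B ** \<Sigma> ** B = mat 1" for B \<Sigma> :: "real^'k^'k"
  proof -
    \<comment> \<open>by the hypothesis this is the inverse of \<open>B\<^sup>T\<close>\<close>
    let ?A = "\<Sigma> ** B"
    have l: "transpose B ** ?A = mat 1" using that by (simp add: matrix_mul_assoc)
    then have r: "?A ** transpose B = mat 1" by (rule matrix_left_right_inverse[THEN iffD1])
    have r': "transpose ?A ** B = mat 1" using arg_cong[OF l, of transpose]
      by (simp add: matrix_transpose_mul transpose_mat)
    then have l': "B ** transpose ?A = mat 1" by (rule matrix_left_right_inverse[THEN iffD1])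
    have "?A ** transpose ?A = \<Sigma> ** (B ** transpose ?A)" by (simp add: matrix_mul_assoc)
    then have "?A ** transpose ?A = \<Sigma>" by (simp only: l' matrix_mul_rid)
    then show ?thesis using l r l' r' unfolding invertible_def by blast
  qed
  obtain A where A: "transpose A ** B = mat 1" "B ** transpose A = mat 1" "invertible A" "A ** transpose A = \<Sigma>"
    using factor[OF BB] by blast
  obtain C where C: "transpose C ** D = mat 1" "D ** transpose C = mat 1" "invertible C" "C ** transpose C = ?\<Gamma>"
    using factor[OF DD] by blast
  have "transpose A ** P = transpose A ** (P ** (D ** transpose C))"
    by (simp only: C matrix_mul_rid)
  also have "\<dots> = transpose A ** (B ** P) ** transpose C"
    by (simp only: BP matrix_mul_assoc)
  also have "\<dots> = P ** transpose C"
    by (simp only: matrix_mul_assoc A matrix_mul_lid)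
  finally have "transpose (transpose A ** P) = transpose (P ** transpose C)" by (rule arg_cong)
  then have "transpose P ** A = C ** transpose P"
    by (simp add: matrix_transpose_mul)
  with A C show thesis using that by blast
qed

section \<open>Marginals of Gaussian measures\<close>

text \<open>
  For a product measure, selecting coordinates is a reindexing along an injection.
\<close>
lemma distr_mvnormal_one_selection:
  fixes P :: "real^'s^'n"
  assumes sel: "selection_matrix S P"
  shows "distr (mvnormal (mat 1)) borel ((*v) (transpose P)) = mvnormal (mat 1)"
proof -
  obtain \<sigma> where bij: "bij_betw \<sigma> UNIV S" and col: "\<And>j. column j P = axis (\<sigma> j) 1"
    using sel unfolding selection_matrix_def by blast
  let ?N = "density lborel std_normal_density"
  let ?r = "\<lambda>f :: 'n \<Rightarrow> real. \<lambda>j\<in>UNIV. f (\<sigma> j)"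
  have vl: "vec_lambda \<in> measurable (\<Pi>\<^sub>M i\<in>(UNIV::'k::finite set). ?N) borel"
    by (rule measurable_vec_lambda) simp
  have r: "?r \<in> measurable (\<Pi>\<^sub>M i\<in>UNIV. ?N) (\<Pi>\<^sub>M j\<in>(UNIV::'s set). ?N)"
    by (intro measurable_restrict measurable_component_singleton) simp
  have comp: "transpose P *v vec_lambda f = vec_lambda (?r f)" for f
    by (simp add: vec_eq_iff transpose_selection_mult[OF col] del: transpose_matrix_vector)
  have "distr (mvnormal (mat 1)) borel ((*v) (transpose P))
      = distr (\<Pi>\<^sub>M i\<in>UNIV. ?N) borel (\<lambda>f. transpose P *v vec_lambda f)"
    unfolding mvnormal_one_eq_distr_PiM
    by (subst distr_distr[OF measurable_matrix_vector vl]) (simp add: o_def)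
  also have "\<dots> = distr (distr (\<Pi>\<^sub>M i\<in>UNIV. ?N) (\<Pi>\<^sub>M j\<in>(UNIV::'s set). ?N) ?r) borel vec_lambda"
    unfolding comp by (subst distr_distr[OF vl r]) (simp add: o_def)
  also have "distr (\<Pi>\<^sub>M i\<in>UNIV. ?N) (\<Pi>\<^sub>M j\<in>(UNIV::'s set). ?N) ?r = (\<Pi>\<^sub>M j\<in>(UNIV::'s set). ?N)"
    by (rule distr_PiM_reindex[of UNIV "\<lambda>_. ?N" \<sigma> UNIV])
       (use bij in \<open>auto simp: bij_betw_def prob_space_normal_density\<close>)
  finally show ?thesis unfolding mvnormal_one_eq_distr_PiM .
qed

text \<open>
  Write the vector as \<open>A z\<close> with \<open>z\<close> standard. Then \<open>P\<^sup>T A z = C (P\<^sup>T z)\<close>, and \<open>P\<^sup>T z\<close> is again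
  standard, so no density has to be integrated out.
\<close>
lemma distr_mvnormal_selection:
  fixes \<Sigma> :: "real^'n^'n" and P :: "real^'s^'n"
  assumes pd: "positive_definite \<Sigma>" and sel: "selection_matrix S P"
  shows "distr (mvnormal \<Sigma>) borel ((*v) (transpose P)) = mvnormal (transpose P ** \<Sigma> ** P)"
proof -
  obtain A C where A: "invertible A" "A ** transpose A = \<Sigma>"
    and C: "invertible C" "C ** transpose C = transpose P ** \<Sigma> ** P"
    and AC: "transpose P ** A = C ** transpose P"
    using compatible_factorization[OF pd sel] by blast
  have m: "(*v) B \<in> measurable (mvnormal E) borel" for B :: "real^'k^'l" and E
    using measurable_matrix_vector measurable_cong_sets[OF sets_mvnormal refl] by blast
  have "distr (mvnormal \<Sigma>) borel ((*v) (transpose P))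
      = distr (distr (mvnormal (mat 1)) borel ((*v) A)) borel ((*v) (transpose P))"
    unfolding distr_mvnormal_one[OF A(1)] A(2) ..
  also have "\<dots> = distr (mvnormal (mat 1)) borel ((*v) (transpose P ** A))"
    by (subst distr_distr[OF measurable_matrix_vector m]) (simp only: matrix_vector_mult_matrix_matrix_mult_compose)
  also have "\<dots> = distr (distr (mvnormal (mat 1)) borel ((*v) (transpose P))) borel ((*v) C)"
    unfolding AC by (subst distr_distr[OF measurable_matrix_vector m]) (simp only: matrix_vector_mult_matrix_matrix_mult_compose)
  also have "\<dots> = mvnormal (transpose P ** \<Sigma> ** P)"
    unfolding distr_mvnormal_one_selection[OF sel] distr_mvnormal_one[OF C(1)] C(2) ..
  finally show ?thesis .
qed

section \<open>Random rows are almost surely independent\<close>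

lemma AE_mvnormal_hyperplane:
  fixes a :: "real^'n"
  assumes "a \<noteq> 0"
  shows "AE x in mvnormal G. a \<bullet> x \<noteq> 0"
proof -
  have "negligible {x. a \<bullet> x = 0}"
    by (rule negligible_hyperplane) (use assms in simp)
  moreover have "closed {x. a \<bullet> x = 0}" by (rule closed_hyperplane)
  ultimately have "{x. a \<bullet> x = 0} \<in> null_sets lborel"
    by (simp add: negligible_iff_null_sets null_sets_completion_iff borel_closed)
  then have "AE x in lborel. a \<bullet> x \<noteq> 0"
    by (rule AE_I') auto
  then show ?thesis
    unfolding mvnormal_def by (subst AE_density) (simp, auto)
qed

text \<open>
  Start from the identity matrix and replace its rows by the random vectors one at a time. As a
  function of the row to be replaced, with the other rows fixed, the determinant is a linear
  functional. It is not the zero functional, since it was nonzero at the unit vector that is being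
  replaced, so it vanishes on a hyperplane only, which is a null set; Fubini then gives the next
  step.
\<close>
lemma AE_det_rows_nonzero:
  fixes N :: "(real^'s) measure"
  assumes prob: "prob_space N" and sets: "sets N = sets borel"
    and null: "\<And>a. a \<noteq> 0 \<Longrightarrow> AE x in N. a \<bullet> x \<noteq> 0"
  shows "AE w in (\<Pi>\<^sub>M i\<in>(UNIV::'s set). N). det (\<chi> i. w i) \<noteq> 0"
proof -
  interpret N: prob_space N by fact
  interpret product_sigma_finite "\<lambda>_::'s. N" by standard
  \<comment> \<open>the matrix after the rows in \<open>I\<close> have been replaced\<close>
  define R where "R I w = (\<chi> i. if i \<in> I then w i else axis i 1)" for I and w :: "'s \<Rightarrow> real^'s"
  have "AE w in (\<Pi>\<^sub>M i\<in>I. N). det (R I w) \<noteq> 0" if "finite I" for I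
    using that
  proof (induction I rule: finite_induct)
    case empty
    have "R {} w = mat 1" for w by (simp add: R_def vec_eq_iff axis_def mat_def)
    then show ?case by simp
  next
    case (insert k I)
    let ?J = "insert k I"
    have meas: "(\<lambda>w. det (R ?J w)) \<in> borel_measurable (\<Pi>\<^sub>M i\<in>?J. N)"
    proof -
      have "(\<lambda>w. R ?J w $ i $ j) \<in> borel_measurable (\<Pi>\<^sub>M i\<in>?J. N)" for i j
      proof (cases "i \<in> ?J")
        case True
        have "(\<lambda>v. v $ j) \<in> borel_measurable N"
          using measurable_vec_nth measurable_cong_sets[OF sets refl] by blast
        from measurable_compose[OF measurable_component_singleton[OF True, where M = "\<lambda>_. N"] this]
        show ?thesis using True by (simp add: R_def)
      qed (simp add: R_def)
      then show ?thesis unfolding det_def by measurable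
    qed
    let ?Z = "{w \<in> space (\<Pi>\<^sub>M i\<in>?J. N). det (R ?J w) = 0}"
    have Z: "?Z \<in> sets (\<Pi>\<^sub>M i\<in>?J. N)" using meas by measurable
    have "AE w in (\<Pi>\<^sub>M i\<in>I. N). (\<integral>\<^sup>+y. indicator ?Z (w(k := y)) \<partial>N) = 0"
      using insert.IH
    proof eventually_elim
      case (elim w)
      let ?D = "\<lambda>y. det (\<chi> i. if i = k then y else R I w $ i)"
      have RD: "det (R ?J (w(k := y))) = ?D y" for y
        using insert.hyps by (intro arg_cong[where f=det]) (auto simp: R_def vec_eq_iff)
      have "linear ?D"
      proof (rule linearI)
        show "?D (x + y) = ?D x + ?D y" for x y
          by (rule det_row_add[of k "\<lambda>_. x" "\<lambda>_. y"])
        show "?D (r *\<^sub>R x) = r *\<^sub>R ?D x" for r x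
          using det_row_mul[of k r "\<lambda>_. x" "\<lambda>i. R I w $ i"]
          by (simp add: scalar_mult_eq_scaleR cong: if_cong)
      qed
      then have lin: "?D y = adjoint ?D 1 \<bullet> y" for y
        using adjoint_works[of ?D y 1] by (simp add: inner_commute)
      have "(\<chi> i. if i = k then axis k 1 else R I w $ i) = R I w"
        using insert.hyps by (auto simp: R_def vec_eq_iff)
      then have "?D (axis k 1) \<noteq> 0" using elim by simp
      then have "adjoint ?D 1 \<noteq> 0" using lin[of "axis k 1"] by (metis inner_zero_left)
      from null[OF this] have "AE y in N. indicator ?Z (w(k := y)) = (0::ennreal)"
        by eventually_elim (simp add: RD lin[symmetric])
      from nn_integral_cong_AE[OF this] show ?case by simp
    qed
    then have "(\<integral>\<^sup>+w. (\<integral>\<^sup>+y. indicator ?Z (w(k := y)) \<partial>N) \<partial>(\<Pi>\<^sub>M i\<in>I. N)) = 0"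
      by (simp cong: nn_integral_cong_AE)
    then have "(\<integral>\<^sup>+w. indicator ?Z w \<partial>(\<Pi>\<^sub>M i\<in>?J. N)) = 0"
      using Z insert.hyps by (subst product_nn_integral_insert) auto
    then have "?Z \<in> null_sets (\<Pi>\<^sub>M i\<in>?J. N)"
      using Z by (simp add: null_sets_def)
    then show ?case by (rule AE_I') auto
  qed
  from this[of UNIV] show ?thesis by (simp add: R_def)
qed

section \<open>Sums of outer products\<close>

lemma sum_matrix_vector_mult:
  fixes A :: "'i \<Rightarrow> real^'n^'m"
  shows "(\<Sum>i\<in>I. A i) *v x = (\<Sum>i\<in>I. A i *v x)"
  by (induction I rule: infinite_finite_induct) (simp_all add: matrix_vector_mult_add_rdistrib)

lemma outer_prod_mult_vec: "outer_prod v *v x = (v \<bullet> x) *\<^sub>R v"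
  by (simp add: vec_eq_iff outer_prod_def matrix_vector_mult_def inner_vec_def sum_distrib_left sum_distrib_right ac_simps)

lemma compress_sum_outer_prod:
  fixes P :: "real^'s^'n"
  shows "transpose P ** (\<Sum>i\<in>I. outer_prod (v i)) ** P = (\<Sum>i\<in>I. outer_prod (transpose P *v v i))"
proof -
  have "(transpose P ** (\<Sum>i\<in>I. outer_prod (v i)) ** P) *v x = (\<Sum>i\<in>I. outer_prod (transpose P *v v i)) *v x" for x
  proof -
    have "(transpose P ** (\<Sum>i\<in>I. outer_prod (v i)) ** P) *v x
        = transpose P *v (\<Sum>i\<in>I. (v i \<bullet> (P *v x)) *\<^sub>R v i)"
      by (simp only: matrix_vector_mul_assoc[symmetric] sum_matrix_vector_mult outer_prod_mult_vec)
    also have "\<dots> = (\<Sum>i\<in>I. transpose P *v ((v i \<bullet> (P *v x)) *\<^sub>R v i))"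
      by (rule linear_sum[OF matrix_vector_mul_linear])
    also have "\<dots> = (\<Sum>i\<in>I. outer_prod (transpose P *v v i)) *v x"
      by (simp only: sum_matrix_vector_mult outer_prod_mult_vec matrix_vector_mult_scaleR
          inner_matrix_vector_eq_transpose)
    finally show ?thesis .
  qed
  then show ?thesis by (subst matrix_eq) blast
qed

text \<open>
  The range of the sum lies in the span of the vectors.
\<close>
lemma rank_sum_outer_prod_le:
  assumes "finite I"
  shows "rank (\<Sum>i\<in>I. outer_prod (v i)) \<le> card I"
proof -
  have "range ((*v) (\<Sum>i\<in>I. outer_prod (v i))) \<subseteq> span (v ` I)"
    unfolding image_subset_iff sum_matrix_vector_mult outer_prod_mult_vec
    by (intro ballI span_sum span_scale span_base imageI)
  then have "rank (\<Sum>i\<in>I. outer_prod (v i)) \<le> dim (v ` I)"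
    unfolding rank_dim_range by (metis dim_span dim_subset)
  also have "\<dots> \<le> card (v ` I)"
    by (rule dim_le_card') (use assms in simp)
  also have "\<dots> \<le> card I"
    by (rule card_image_le[OF assms])
  finally show ?thesis .
qed

text \<open>
  The quadratic form of \<open>T = \<Sum>\<^sub>i v\<^sub>i v\<^sub>i\<^sup>T\<close> is \<open>\<Sum>\<^sub>i (v\<^sub>i \<bullet> x)\<^sup>2\<close>, so a vector in the kernel of \<open>T\<close> is
  orthogonal to all \<open>v\<^sub>i\<close>. It is therefore zero as soon as some of the \<open>v\<^sub>i\<close> form a basis.
\<close>
lemma invertible_sum_outer_prod:
  fixes v :: "'i \<Rightarrow> real^'s"
  assumes "finite I" "g ` UNIV \<subseteq> I" and det: "det (\<chi> j. v (g j)) \<noteq> 0"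
  shows "invertible (\<Sum>i\<in>I. outer_prod (v i))"
proof -
  let ?T = "\<Sum>i\<in>I. outer_prod (v i)"
  let ?W = "\<chi> j. v (g j)"
  have "x = 0" if "?T *v x = 0" for x
  proof -
    have "(\<Sum>i\<in>I. (v i \<bullet> x)\<^sup>2) = x \<bullet> (?T *v x)"
      by (simp add: sum_matrix_vector_mult outer_prod_mult_vec inner_sum_right power2_eq_square inner_commute)
    then have "v i \<bullet> x = 0" if "i \<in> I" for i
      using that \<open>?T *v x = 0\<close> assms(1) by (simp add: sum_nonneg_eq_0_iff)
    then have "?W *v x = 0"
      using assms(2) by (simp add: vec_eq_iff matrix_vector_mul_component image_subset_iff)
    moreover have "inj ((*v) ?W)"
      using det by (metis invertible_det_nz invertible_left_inverse matrix_left_invertible_injective)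
    ultimately show ?thesis by (metis injD matrix_vector_mult_0_right)
  qed
  then show ?thesis
    by (metis invertible_left_inverse matrix_left_invertible_ker)
qed

lemma borel_measurable_outer_prod [measurable]:
  "outer_prod \<in> borel_measurable (borel :: (real^'n) measure)"
  unfolding outer_prod_def[abs_def]
  by (intro borel_measurable_continuous_onI continuous_on_vec_lambda continuous_intros)

lemma (in prob_space) distr_iid_eq_PiM:
  assumes "I \<noteq> {}" and ind: "indep_vars (\<lambda>_. borel) X I"
    and law: "\<And>i. i \<in> I \<Longrightarrow> distr M borel (X i) = N"
  shows "distr M (\<Pi>\<^sub>M i\<in>I. borel) (\<lambda>\<omega>. \<lambda>i\<in>I. X i \<omega>) = (\<Pi>\<^sub>M i\<in>I. N)"
proof -
  have rv: "random_variable borel (X i)" if "i \<in> I" for i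
    using ind that by (simp add: indep_vars_def)
  have "distr M (\<Pi>\<^sub>M i\<in>I. borel) (\<lambda>\<omega>. \<lambda>i\<in>I. X i \<omega>) = (\<Pi>\<^sub>M i\<in>I. distr M borel (X i))"
    using indep_vars_iff_distr_eq_PiM'[where M' = "\<lambda>_. borel" and X = X, OF assms(1) rv] ind by blast
  also have "\<dots> = (\<Pi>\<^sub>M i\<in>I. N)"
    by (rule PiM_cong) (simp_all add: law)
  finally show ?thesis .
qed

text \<open>
  Any selection of as many vectors as the dimension is already almost surely a basis.
\<close>
lemma (in prob_space) AE_invertible_sum_outer_prod:
  fixes X :: "'i \<Rightarrow> 'a \<Rightarrow> real^'s"
  assumes "finite I" "CARD('s) \<le> card I"
    and ind: "indep_vars (\<lambda>_. borel) X I"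
    and law: "\<And>i. i \<in> I \<Longrightarrow> distr M borel (X i) = N"
    and null: "\<And>a. a \<noteq> 0 \<Longrightarrow> AE x in N. a \<bullet> x \<noteq> 0"
  shows "AE \<omega> in M. invertible (\<Sum>i\<in>I. outer_prod (X i \<omega>))"
proof -
  obtain g :: "'s \<Rightarrow> 'i" where g: "inj g" "range g \<subseteq> I"
    using card_le_inj[OF finite assms(1), of "UNIV :: 's set"] assms(2) by auto
  have "I \<noteq> {}" using g by auto
  then obtain i where i: "i \<in> I" by blast
  have rv: "random_variable borel (X i)" if "i \<in> I" for i
    using ind that by (simp add: indep_vars_def)
  have N: "prob_space N" "sets N = sets borel"
    using law[OF i] prob_space_distr[OF rv[OF i]] by (auto simp flip: law[OF i])
  let ?sel = "\<lambda>x. \<lambda>j\<in>UNIV. x (g j)" and ?X = "\<lambda>\<omega>. \<lambda>i\<in>I. X i \<omega>"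
  have sel: "?sel \<in> measurable (\<Pi>\<^sub>M i\<in>I. N) (\<Pi>\<^sub>M j\<in>(UNIV::'s set). N)"
    by (intro measurable_restrict measurable_component_singleton) (use g in auto)
  have X: "?X \<in> measurable M (\<Pi>\<^sub>M i\<in>I. borel)"
    by (intro measurable_restrict rv)
  have reindex: "distr (\<Pi>\<^sub>M i\<in>I. N) (\<Pi>\<^sub>M j\<in>(UNIV::'s set). N) ?sel = (\<Pi>\<^sub>M j\<in>(UNIV::'s set). N)"
    by (rule distr_PiM_reindex[of I "\<lambda>_. N" g UNIV]) (use g N in auto)
  have "AE x in distr (\<Pi>\<^sub>M i\<in>I. N) (\<Pi>\<^sub>M j\<in>(UNIV::'s set). N) ?sel. det (\<chi> j. x j) \<noteq> 0"
    unfolding reindex by (rule AE_det_rows_nonzero[OF N null])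
  from AE_distrD[OF sel this] have "AE x in (\<Pi>\<^sub>M i\<in>I. N). det (\<chi> j. x (g j)) \<noteq> 0"
    by simp
  then have "AE x in distr M (\<Pi>\<^sub>M i\<in>I. borel) ?X. det (\<chi> j. x (g j)) \<noteq> 0"
    by (subst distr_iid_eq_PiM[OF \<open>I \<noteq> {}\<close> ind law]) simp_all
  from AE_distrD[OF X this] have "AE \<omega> in M. det (\<chi> j. X (g j) \<omega>) \<noteq> 0"
    using g(2) by (simp add: image_subset_iff)
  then show ?thesis
    by eventually_elim (rule invertible_sum_outer_prod[OF assms(1) g(2)])
qed

theorem lemma3p3:
  fixes M :: "'a measure"
    and \<Sigma> :: "real^'n^'n"
    and u :: "nat \<Rightarrow> 'a \<Rightarrow> real^'n"
    and m :: nat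
    and S :: "'n set"
    and P :: "real^'s^'n"
    and \<Sigma>t :: "'a \<Rightarrow> real^'n^'n"
    and \<Sigma>tS :: "'a \<Rightarrow> real^'s^'s"
  assumes "prob_space M"
    and "positive_definite \<Sigma>"
    and "prob_space.indep_vars M (\<lambda>_. borel) u {1..m}"
    and "\<And>i. i \<in> {1..m} \<Longrightarrow> distr M borel (u i) = mvnormal \<Sigma>"
    and "card S \<le> m"
    and "selection_matrix S P"
  defines "\<Sigma>t \<equiv> (\<lambda>\<omega>. \<Sum>i\<in>{1..m}. outer_prod (u i \<omega>))"
    and "\<Sigma>tS \<equiv> (\<lambda>\<omega>. transpose P ** \<Sigma>t \<omega> ** P)"
  shows "(\<forall>\<omega>\<in>space M. rank (\<Sigma>t \<omega>) \<le> m) \<and>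
         \<Sigma>tS \<in> borel_measurable M \<and>
         distr M borel \<Sigma>tS = wishart (transpose P ** \<Sigma> ** P) m \<and>
         (AE \<omega> in M. invertible (\<Sigma>tS \<omega>)) \<and>
         (AE \<omega> in M. rank (\<Sigma>tS \<omega>) = card S)"
proof -
  interpret prob_space M by fact
  let ?\<Gamma> = "transpose P ** \<Sigma> ** P"
  define w where "w i \<omega> = transpose P *v u i \<omega>" for i \<omega>
  have card_S: "card S = CARD('s)"
    using assms(6) unfolding selection_matrix_def by (metis bij_betw_same_card)
  \<comment> \<open>an index type is nonempty, hence so is \<open>S\<close>\<close>
  have m: "{1..m} \<noteq> {}"
  proof -
    have "0 < m" using card_S assms(5) zero_less_card_finite[where 'a = 's] by linarith
    then show ?thesis by simp
  qed
  have \<Sigma>tS: "\<Sigma>tS = (\<lambda>\<omega>. \<Sum>i\<in>{1..m}. outer_prod (w i \<omega>))"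
    unfolding \<Sigma>tS_def \<Sigma>t_def w_def compress_sum_outer_prod ..
  have u_rv: "random_variable borel (u i)" if "i \<in> {1..m}" for i
    using assms(3) that by (simp add: indep_vars_def)
  have w_indep: "indep_vars (\<lambda>_. borel) w {1..m}"
    unfolding w_def by (rule indep_vars_compose2[OF assms(3)]) (rule measurable_matrix_vector)
  then have w_rv: "random_variable borel (w i)" if "i \<in> {1..m}" for i
    using that by (simp add: indep_vars_def)
  have w_law: "distr M borel (w i) = mvnormal ?\<Gamma>" if "i \<in> {1..m}" for i
  proof -
    have "distr M borel (w i) = distr (distr M borel (u i)) borel ((*v) (transpose P))"
      unfolding w_def by (subst distr_distr[OF measurable_matrix_vector u_rv[OF that]]) (simp only: o_def)
    then show ?thesis
      by (simp only: assms(4)[OF that] distr_mvnormal_selection[OF assms(2,6)])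
  qed
  have joint: "distr M (\<Pi>\<^sub>M i\<in>{1..m}. borel) (\<lambda>\<omega>. \<lambda>i\<in>{1..m}. w i \<omega>) = (\<Pi>\<^sub>M i\<in>{1..m}. mvnormal ?\<Gamma>)"
    by (rule distr_iid_eq_PiM[OF m w_indep w_law])
  have rank_le: "rank (\<Sigma>t \<omega>) \<le> m" for \<omega>
    using rank_sum_outer_prod_le[of "{1..m}" "\<lambda>i. u i \<omega>"] by (simp add: \<Sigma>t_def)
  have meas: "\<Sigma>tS \<in> borel_measurable M"
    unfolding \<Sigma>tS by (intro borel_measurable_sum measurable_compose[OF w_rv borel_measurable_outer_prod])
  have "distr M borel \<Sigma>tS
      = distr (distr M (\<Pi>\<^sub>M i\<in>{1..m}. borel) (\<lambda>\<omega>. \<lambda>i\<in>{1..m}. w i \<omega>)) borel (\<lambda>v. \<Sum>i\<in>{1..m}. outer_prod (v i))"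
  proof (subst distr_distr)
    show "(\<lambda>v. \<Sum>i\<in>{1..m}. outer_prod (v i)) \<in> borel_measurable (\<Pi>\<^sub>M i\<in>{1..m}. borel :: (real^'s) measure)"
      by measurable
    show "(\<lambda>\<omega>. \<lambda>i\<in>{1..m}. w i \<omega>) \<in> measurable M (\<Pi>\<^sub>M i\<in>{1..m}. borel)"
      by (intro measurable_restrict w_rv)
  qed (auto simp: \<Sigma>tS fun_eq_iff intro!: arg_cong[where f = "distr M borel"] sum.cong)
  then have law: "distr M borel \<Sigma>tS = wishart ?\<Gamma> m"
    unfolding joint wishart_def .
  have inv: "AE \<omega> in M. invertible (\<Sigma>tS \<omega>)"
    unfolding \<Sigma>tS
    by (rule AE_invertible_sum_outer_prod[OF _ _ w_indep w_law AE_mvnormal_hyperplane])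
       (use card_S assms(5) in simp_all)
  then have "AE \<omega> in M. rank (\<Sigma>tS \<omega>) = card S"
    by eventually_elim
       (simp add: card_S full_rank_injective invertible_left_inverse matrix_left_invertible_injective)
  with rank_le meas law inv show ?thesis by blast
qed

end
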